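(* Let $U$ be a unital of order $n \ge 2$, let $G_U$ be its incidence graph, and let $c(n) = n^2 - \frac{\sqrt{8n^2+9}-3}{2}$. Then \[ \frac{2 \left(n^3+1-\lfloor c(n)\rfloor\right)}{n^2(n^2+1)} \le i(G_U) \le \frac{2 \left(n^3+1-\min\{m(U), \lfloor c(n)\rfloor\}\right)}{n^2(n^2+1)}. \]
   Context: A $2$-$(v,k,\lambda)$ design is a pair $(P,\mathcal{B})$ where $P$ is a set of $v$ points and $\mathcal{B}$ a set of $k$-subsets of $P$ (blocks, also called lines) such that every $2$-subset of $P$ lies in exactly $\lambda$ blocks. A unital of order $n\ge 2$ is a $2$-$(n^3+1,n+1,1)$ design. The incidence graph $G_D$ of a design $D=(P,\mathcal{B})$ is the bipartite graph on vertex set $P\cup\mathcal{B}$ where a point $p$ is adjacent to a block $B$ iff $p\in B$. For a graph $G$ and $S\subseteq V(G)$, $N(S)$ is the set of vertices in $V(G)\setminus S$ adjacent to at least one vertex of $S$; the vertex-isoperimetric number is $i(G)=\min\{|N(S)|/|S| : \emptyset\ne S\subseteq V(G),\ |S|\le |V(G)|/2\}$. A $k$-arc ($k\ge 3$) of a unital is a set of $k$ points no three of which lie on a common line; $m(U)=\max\{k : k\ge 3, U \text{ contains a } k\text{-arc}\}$. *)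

theory Defs
  imports Complex_Main "Graph_Theory.Pair_Digraph"
begin

definition two_design :: "nat \<Rightarrow> nat \<Rightarrow> nat \<Rightarrow> 'a set \<Rightarrow> 'a set set \<Rightarrow> bool" where
  "two_design v k l P Bs \<longleftrightarrow>
     finite P \<and> card P = v \<and>
     (\<forall>B\<in>Bs. B \<subseteq> P \<and> card B = k) \<and>
     (\<forall>T. T \<subseteq> P \<and> card T = 2 \<longrightarrow> card {B \<in> Bs. T \<subseteq> B} = l)"

definition unital :: "nat \<Rightarrow> 'a set \<Rightarrow> 'a set set \<Rightarrow> bool" where
  "unital n P Bs \<longleftrightarrow> n \<ge> 2 \<and> two_design (n ^ 3 + 1) (n + 1) 1 P Bs"

text \<open>Undirected simple graphs are represented, as in the locale \<^locale>\<open>pair_graph\<close>, by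
  symmetric loop-free digraphs: each edge occurs as both of its orientations.\<close>

definition incidence_graph :: "'a set \<Rightarrow> 'a set set \<Rightarrow> ('a + 'a set) pair_pre_digraph" where
  "incidence_graph P Bs =
     \<lparr> pverts = P <+> Bs,
       parcs = {(Inl p, Inr B) | p B. p \<in> P \<and> B \<in> Bs \<and> p \<in> B} \<union>
               {(Inr B, Inl p) | p B. p \<in> P \<and> B \<in> Bs \<and> p \<in> B} \<rparr>"

lemma pair_graph_incidence_graph:
  assumes "two_design v k l P Bs"
  shows "pair_graph (incidence_graph P Bs)"
proof -
  have P: "finite P" and "Bs \<subseteq> Pow P"
    using assms by (auto simp: two_design_def)
  then have Bs: "finite Bs"
    by (meson finite_Pow_iff finite_subset)
  have sub: "parcs (incidence_graph P Bs) \<subseteq> (P <+> Bs) \<times> (P <+> Bs)"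
    by (auto simp: incidence_graph_def)
  have fin: "finite (parcs (incidence_graph P Bs))"
    by (rule finite_subset[OF sub]) (use P Bs in auto)
  have sym: "symmetric (with_proj (incidence_graph P Bs))"
    by (auto simp: symmetric_def sym_def incidence_graph_def)
  show ?thesis
    using P Bs fin sym by unfold_locales (auto simp: incidence_graph_def)
qed

definition nbhd :: "'v pair_pre_digraph \<Rightarrow> 'v set \<Rightarrow> 'v set" where
  "nbhd G S = {w \<in> pverts G - S. \<exists>u\<in>S. u \<rightarrow>\<^bsub>with_proj G\<^esub> w}"

text \<open>\<^const>\<open>Min\<close> is meaningful only on finite nonempty sets, so this is intended for finite
  graphs with at least two vertices.\<close>

definition vertex_isoperimetric_number :: "'v pair_pre_digraph \<Rightarrow> real" where
  "vertex_isoperimetric_number G =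
     Min {real (card (nbhd G S)) / real (card S) | S.
            S \<subseteq> pverts G \<and> S \<noteq> {} \<and> real (card S) \<le> real (card (pverts G)) / 2}"

definition is_arc :: "'a set \<Rightarrow> 'a set set \<Rightarrow> nat \<Rightarrow> 'a set \<Rightarrow> bool" where
  "is_arc P Bs k A \<longleftrightarrow>
     k \<ge> 3 \<and> A \<subseteq> P \<and> card A = k \<and>
     \<not> (\<exists>T B. T \<subseteq> A \<and> card T = 3 \<and> B \<in> Bs \<and> T \<subseteq> B)"

text \<open>In a unital, two points and a third one off their line form a 3-arc, so the maximum
  is over a finite nonempty set.\<close>

definition max_arc_size :: "'a set \<Rightarrow> 'a set set \<Rightarrow> nat" where
  "max_arc_size P Bs = Max {k. \<exists>A. is_arc P Bs k A}"

definition unital_c :: "nat \<Rightarrow> real" where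
  "unital_c n = real n ^ 2 - (sqrt (8 * real n ^ 2 + 9) - 3) / 2"

end

theory Submission
  imports Defs "HOL-Analysis.Convex"
begin

text \<open>Write $v = n^3 + 1$ for the number of points and $h = n^2(n^2+1)/2$ for the largest
  admissible size of $S$, and let $a = \lfloor c(n) \rfloor$. Counting $\sum_B |B \cap X|$ and
  $\sum_B |B \cap X|^2$ shows that an $x$-set $X$ of points meets at least $x n^2 - x(x-1)/2$ lines,
  with equality for arcs, and $c(n)$ is the root $x$ of $x + x n^2 - x(x-1)/2 = h$. Hence an
  arc of size $k \le a$, all lines meeting it and further lines up to total size $h$ form a set
  with at most $v - k$ neighbours.

  For the lower bound let $S$ consist of the points $X$ and the lines $L$, let $Y$ be the set of
  points outside $X$ not covered by $L$, and $K$ the set of lines outside $L$ meeting $X$, so that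
  $|N(S)| = v - x - y + k$ in terms of the cardinalities. A line meeting both $X$ and
  $Y$ is in $K$ and accounts for at most $q = \lfloor (n+1)^2/4 \rfloor$ pairs of $X \times Y$,
  so $xy \le qk$. If $|N(S)| < v - a$, this forces exactly one of $x$ and $y$ to exceed $q$. If it is $y$,
  then $k \ge 2x$, and the Cauchy--Schwarz bound on the number of lines missing $Y$
  gives the claim. If it is $x$, then so many lines meet $X$ that $|N(S)| \ge v - a$ after all.\<close>

section \<open>Integer arithmetic of the floor of c(n) and of the expansion inequality\<close>

text \<open>The integer $d = n^2 - \lfloor c(n) \rfloor$ is the least one with $d(d+3) \ge 2n^2$.\<close>

lemma unital_c_floor:
  assumes "n \<ge> 2"
  obtains d :: int where "\<lfloor>unital_c n\<rfloor> = int n ^ 2 - d" "d \<ge> 1"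
    "2 * int n ^ 2 \<le> d * (d + 3)" "(d - 1) * (d + 2) < 2 * int n ^ 2"
    "2 * d \<le> 3 * int n"
proof -
  define s where "s = sqrt (8 * real n ^ 2 + 9)"
  define d where "d = int n ^ 2 - \<lfloor>unital_c n\<rfloor>"
  have s2: "s ^ 2 = 8 * real n ^ 2 + 9"
    by (simp add: s_def)
  have "sqrt (3 ^ 2) \<le> s"
    unfolding s_def by (rule real_sqrt_le_mono) simp
  then have s3: "s \<ge> 3" by simp
  have c: "unital_c n = real n ^ 2 - (s - 3) / 2"
    by (simp add: unital_c_def s_def)
  have "real_of_int \<lfloor>unital_c n\<rfloor> \<le> unital_c n" "unital_c n < real_of_int \<lfloor>unital_c n\<rfloor> + 1"
    by linarith+
  \<comment> \<open>Here \<open>d\<close> is the ceiling of \<open>(s - 3) / 2\<close>. Squaring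
    \<open>s \<le> 2d + 3\<close> and \<open>2d + 1 < s\<close> removes the root and yields the two
    quadratic inequalities.\<close>
  then have d: "s \<le> 2 * real_of_int d + 3" "2 * real_of_int d + 1 < s"
    unfolding d_def of_int_diff of_int_power of_int_of_nat_eq using c by argo+
  from d(1) s3 have d0: "d \<ge> 0" by linarith
  from d(1) s3 have "s ^ 2 \<le> (2 * real_of_int d + 3) ^ 2"
    by (intro power_mono) auto
  then have "real_of_int (2 * int n ^ 2) \<le> real_of_int (d * (d + 3))"
    unfolding s2 by (simp add: power2_eq_square algebra_simps)
  then have i1: "2 * int n ^ 2 \<le> d * (d + 3)" by linarith
  from d(2) d0 have "(2 * real_of_int d + 1) ^ 2 < s ^ 2"
    by (intro power_strict_mono) auto
  then have "real_of_int ((d - 1) * (d + 2)) < real_of_int (2 * int n ^ 2)"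
    unfolding s2 by (simp add: power2_eq_square algebra_simps)
  then have i2: "(d - 1) * (d + 2) < 2 * int n ^ 2" by linarith
  have "d \<noteq> 0" using i1 assms by auto
  with d0 have i3: "d \<ge> 1" by linarith
  \<comment> \<open>If \<open>2d \<ge> 3n + 1\<close>, then \<open>4(d - 1)(d + 2)\<close> is at
    least \<open>(3n - 1)(3n + 5)\<close>, which exceeds \<open>8n^2\<close>.\<close>
  have i4: "2 * d \<le> 3 * int n"
  proof (rule ccontr)
    assume "\<not> ?thesis"
    then have "3 * int n - 1 \<le> 2 * (d - 1)" "3 * int n + 5 \<le> 2 * (d + 2)" by simp_all
    then have "(3 * int n - 1) * (3 * int n + 5) \<le> (2 * (d - 1)) * (2 * (d + 2))"
      using assms i3 by (intro mult_mono) auto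
    moreover have "(2 * (d - 1)) * (2 * (d + 2)) < 8 * int n ^ 2"
      using i2 by (simp add: algebra_simps)
    moreover have "(3 * int n - 1) * (3 * int n + 5) = 9 * int n ^ 2 + 12 * int n - 5"
      by (simp add: algebra_simps power2_eq_square)
    moreover have "0 \<le> int n ^ 2" by simp
    ultimately show False using assms by linarith
  qed
  show thesis
    by (rule that[of d]) (use i1 i2 i3 i4 in \<open>auto simp: d_def\<close>)
qed

text \<open>The letters $x, y, l, k$ are the cardinalities of $X, Y, L, K$; assumption \<open>meet\<close> is
  stated for all $j \le x$ because the number of lines met is monotone in $X$, whereas
  $j n^2 - j(j-1)/2$ decreases for large $j$.\<close>

lemma expansion_arithmetic:
  fixes n q d a x y l k v :: int
  assumes n: "n \<ge> 2"
    and q: "q = (n + 1) ^ 2 div 4"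
    and a: "a = n ^ 2 - d" and d1: "d \<ge> 1"
    and dlt: "(d - 1) * (d + 2) < 2 * n ^ 2"
    and dn: "2 * d \<le> 3 * n"
    and v: "v = n ^ 3 + 1"
    and nonneg: "0 \<le> x" "0 \<le> y" "0 \<le> l" "0 \<le> k"
    and half: "2 * (x + l) \<le> n ^ 2 * (n ^ 2 + 1)"
    and cross: "x * y \<le> q * k"
    and meet: "\<And>j. 0 \<le> j \<Longrightarrow> j \<le> x \<Longrightarrow> 2 * n ^ 2 * j - j * (j - 1) \<le> 2 * (l + k)"
    and miss: "l * (n ^ 2 + y - 1) \<le> n ^ 2 * (n - 1) * (v - y)"
  shows "2 * (v - a) * (x + l) \<le> n ^ 2 * (n ^ 2 + 1) * (v - x - y + k)"
proof -
  have q2: "2 \<le> q"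
  proof -
    have "3 ^ 2 \<le> (n + 1) ^ 2" using n by (intro power_mono) auto
    then show ?thesis unfolding q by simp
  qed
  have aq: "2 * q \<le> a + 2"
  proof -
    have q4: "4 * q \<le> (n + 1) ^ 2" unfolding q by simp
    \<comment> \<open>For \<open>n \<ge> 5\<close> the estimates \<open>4q \<le> (n + 1)^2\<close>
      and \<open>2d \<le> 3n\<close> suffice. For \<open>n = 4\<close> the rounding in
      \<open>q\<close> is needed, and for \<open>n = 2, 3\<close> the sharper \<open>dlt\<close>
      replaces \<open>2d \<le> 3n\<close>.\<close>
    consider "n = 2" | "n = 3" | "n = 4" | "n \<ge> 5" using n by linarith
    then show ?thesis
    proof cases
      case 1
      have "d \<le> 2"
      proof (rule ccontr)
        assume "\<not> ?thesis"
        then have "2 * 5 \<le> (d - 1) * (d + 2)" by (intro mult_mono) auto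
        then show False using dlt 1 by simp
      qed
      then show ?thesis using 1 by (simp add: a q)
    next
      case 2
      have "d \<le> 3"
      proof (rule ccontr)
        assume "\<not> ?thesis"
        then have "3 * 6 \<le> (d - 1) * (d + 2)" by (intro mult_mono) auto
        then show False using dlt 2 by simp
      qed
      then show ?thesis using 2 by (simp add: a q)
    next
      case 3
      then show ?thesis using dn by (simp add: a q)
    next
      case 4
      then have "5 * n \<le> n * n" by (intro mult_right_mono) auto
      then show ?thesis using q4 dn unfolding a by (simp add: power2_eq_square algebra_simps)
    qed
  qed
  have v_a: "0 \<le> v - a"
  proof -
    have "n ^ 2 * 1 \<le> n ^ 2 * n" using n by (intro mult_left_mono) auto
    then show ?thesis using d1 by (simp add: v a power3_eq_cube power2_eq_square)
  qed
  \<comment> \<open>By \<open>half\<close>, \<open>x + l\<close> is at most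
    \<open>n^2(n^2 + 1)/2\<close>, so a neighbourhood of size at least \<open>v - a\<close> is
    enough.\<close>
  have done_if: ?thesis if "v - a \<le> v - x - y + k"
  proof -
    have "2 * (v - a) * (x + l) = (v - a) * (2 * (x + l))" by (simp only: ac_simps)
    also have "\<dots> \<le> (v - x - y + k) * (n ^ 2 * (n ^ 2 + 1))"
      using that half nonneg v_a by (intro mult_mono[where a = "v - a"]) simp_all
    finally show ?thesis by (simp add: mult.commute)
  qed
  show ?thesis
  proof (cases "v - a \<le> v - x - y + k")
    case False
    then have k: "k \<le> x + y - a - 1" by linarith
    have "q * k \<le> q * (x + y - a - 1)" using k q2 by (intro mult_left_mono) auto
    with cross have xy: "x * y \<le> q * (x + y - a - 1)" by linarith
    \<comment> \<open>The bound \<open>xy\<close> says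
      \<open>(x - q)(y - q) \<le> q(q - a - 1)\<close>, and the right-hand side is negative by
      \<open>aq\<close> and \<open>q2\<close>. Hence exactly one of \<open>x\<close>,
      \<open>y\<close> exceeds \<open>q\<close>.\<close>
    consider "0 \<le> (x - q) * (y - q)" | "x < q" "q < y" | "q < x" "y < q"
      by (metis linorder_neqE mult_nonneg_nonneg mult_nonpos_nonpos diff_ge_0_iff_ge
          diff_le_0_iff_le less_imp_le order_refl)
    then show ?thesis
    proof cases
      case 1
      then have "q * (x + y - q) \<le> x * y" by (simp add: algebra_simps)
      with xy have "q * (x + y - q) \<le> q * (x + y - a - 1)" by linarith
      then have "a + 1 \<le> q" using q2 by auto
      then show ?thesis using aq q2 by linarith
    next
      case 2
      have "0 \<le> x * (y - q)" using 2 nonneg by simp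
      also have "\<dots> \<le> q * (y - a - 1)" using xy by (simp add: algebra_simps)
      finally have ya: "a + 1 \<le> y" using q2 by (simp add: zero_le_mult_iff)
      \<comment> \<open>Since \<open>y \<ge> a + 1 \<ge> 2q - 1\<close>, \<open>cross\<close> gives
        \<open>x(2q - 1) \<le> qk\<close>; with \<open>k \<le> 2x - 1\<close> this would force
        \<open>x \<ge> q\<close>. The bound lets the claim split into a part for \<open>x\<close>
        against \<open>k - x\<close> and a part for \<open>l\<close> against
        \<open>v - y\<close>.\<close>
      have "2 * x \<le> k"
      proof (rule ccontr)
        assume "\<not> ?thesis"
        then have "q * k \<le> q * (2 * x - 1)" using q2 by (intro mult_left_mono) auto
        moreover have "x * (2 * q - 1) \<le> x * y" using ya aq nonneg by (intro mult_left_mono) auto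
        ultimately have "x * (2 * q - 1) \<le> q * (2 * x - 1)" using cross by linarith
        then show False using 2 by (simp add: algebra_simps)
      qed
      moreover have x_coeff: "2 * (v - a) \<le> n ^ 2 * (n ^ 2 + 1)"
      proof -
        have "2 * (v - a) \<le> 2 * n ^ 3" using aq q2 unfolding v by simp
        also have "\<dots> \<le> (n * (n - 1)) ^ 2 + 2 * n ^ 3" by simp
        also have "\<dots> = n ^ 2 * (n ^ 2 + 1)" by algebra
        finally show ?thesis .
      qed
      ultimately have x_part: "2 * (v - a) * x \<le> n ^ 2 * (n ^ 2 + 1) * (k - x)"
        using nonneg by (intro mult_mono[OF x_coeff]) auto
      have l_part: "2 * (v - a) * l \<le> n ^ 2 * (n ^ 2 + 1) * (v - y)"
      proof -
        define w where "w = n ^ 2 + y - 1"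
        have w: "w > 0" using n ya aq q2 unfolding w_def
          by (smt (verit) zero_less_power)
        \<comment> \<open>Multiplying the claim by \<open>w\<close> and applying \<open>miss\<close>
          reduces it to this inequality. From \<open>y \<ge> a + 1\<close> comes
          \<open>w \<ge> 2n^2 - d\<close>, and \<open>2d \<le> 3n\<close> then leaves a polynomial
          in \<open>n\<close> alone.\<close>
        have key: "2 * (v - a) * (n - 1) \<le> (n ^ 2 + 1) * w"
        proof -
          have dn': "(2 * d) * (n ^ 2 + 2 * n - 1) \<le> 3 * n * (n ^ 2 + 2 * n - 1)"
            using dn n one_le_power[of n 2] by (intro mult_right_mono) linarith+
          have "8 * n ^ 3 - 4 * n + 4 - 3 * n * (n ^ 2 + 2 * n - 1)
              = 5 * (n ^ 2 * (n - 2)) + 4 * (n * (n - 2)) + 7 * n + 4" by algebra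
          also have "\<dots> \<ge> 0" using n by simp
          finally have "0 \<le> (8 * n ^ 3 - 4 * n + 4) - (2 * d) * (n ^ 2 + 2 * n - 1)"
            using dn' by simp
          also have "\<dots> = 2 * ((n ^ 2 + 1) * (2 * n ^ 2 - d) - 2 * (v - a) * (n - 1))"
            unfolding v a by algebra
          finally have "2 * (v - a) * (n - 1) \<le> (n ^ 2 + 1) * (2 * n ^ 2 - d)" by simp
          also have "\<dots> \<le> (n ^ 2 + 1) * w"
            using ya by (intro mult_left_mono) (auto simp: w_def a)
          finally show ?thesis .
        qed
        have "w * (2 * (v - a) * l) = 2 * (v - a) * (l * w)" by (simp only: ac_simps)
        also have "\<dots> \<le> 2 * (v - a) * (n ^ 2 * (n - 1) * (v - y))"
          using miss v_a unfolding w_def by (intro mult_left_mono) auto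
        also have "\<dots> = (2 * (v - a) * (n - 1)) * (n ^ 2 * (v - y))" by (simp only: ac_simps)
        also have "\<dots> \<le> ((n ^ 2 + 1) * w) * (n ^ 2 * (v - y))"
        proof (intro mult_right_mono key)
          \<comment> \<open>The sign of \<open>v - y\<close> is read off \<open>miss\<close>, whose
            left-hand side is nonnegative.\<close>
          have "0 \<le> l * w" using nonneg w by simp
          then have "0 \<le> (n ^ 2 * (n - 1)) * (v - y)" using miss unfolding w_def by linarith
          moreover have "0 < n ^ 2 * (n - 1)" using n by simp
          ultimately have "0 \<le> v - y" by (meson mult_less_0_iff not_less)
          then show "0 \<le> n ^ 2 * (v - y)" by simp
        qed
        also have "\<dots> = w * (n ^ 2 * (n ^ 2 + 1) * (v - y))" by (simp only: ac_simps)
        finally show ?thesis using w by (simp only: mult_le_cancel_left_pos)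
      qed
      show ?thesis using x_part l_part by (simp add: algebra_simps)
    next
      case 3
      have "0 \<le> y * (x - q)" using 3 nonneg by simp
      also have yx: "\<dots> \<le> q * (x - a - 1)" using xy by (simp add: algebra_simps)
      finally have xa: "a + 1 \<le> x" using q2 by (simp add: zero_le_mult_iff)
      \<comment> \<open>After cancelling \<open>2l\<close> from both ends, this chain is the premise
        of \<open>done_if\<close>.\<close>
      have "2 * (x + l) + 2 * y \<le> n ^ 2 * (n ^ 2 + 1) + 2 * y"
        using half by simp
      also have "\<dots> \<le> 2 * (l + k) + 2 * a"
      proof (cases "n ^ 2 \<le> x")
        case True
        \<comment> \<open>The integer \<open>j = n^2\<close> maximizes
          \<open>2n^2 j - j(j - 1)\<close>, with value \<open>n^2(n^2 + 1)\<close>; moreover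
          \<open>y < q \<le> a\<close>.\<close>
        then show ?thesis using meet[of "n ^ 2"] 3 aq q2 by (simp add: algebra_simps)
      next
        case False
        \<comment> \<open>Having \<open>e\<close> points fewer than \<open>n^2\<close> lowers that
          maximum by \<open>e(e + 1)\<close>. This loss has to be absorbed by
          \<open>2a - 2y\<close>.\<close>
        define e where "e = n ^ 2 - x"
        have e: "0 \<le> e" "e \<le> d - 1" using False xa by (auto simp: e_def a)
        have "n ^ 2 * (n ^ 2 + 1) - e * (e + 1) = 2 * n ^ 2 * x - x * (x - 1)"
          unfolding e_def by algebra
        with meet[of x] nonneg have m: "n ^ 2 * (n ^ 2 + 1) - e * (e + 1) \<le> 2 * (l + k)" by simp
        have "e * (e + 1) + 2 * y \<le> 2 * a"
        proof -
          \<comment> \<open>Parity sharpens the strict inequality \<open>dlt\<close> by one more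
            unit, which is what \<open>d(d - 1) \<le> 2a\<close> requires.\<close>
          have "even ((d - 1) * (d + 2))" by simp
          then obtain j where "(d - 1) * (d + 2) = 2 * j" by (rule evenE)
          with dlt have "(d - 1) * (d + 2) + 2 \<le> 2 * n ^ 2" by simp
          then have A: "d * (d - 1) \<le> 2 * a" by (simp add: a algebra_simps)
          \<comment> \<open>The right-hand side is \<open>x - a - 1\<close>. If it is
            \<open>0\<close>, \<open>yx\<close> forces \<open>y = 0\<close>; otherwise
            \<open>x \<ge> a + 2 \<ge> 2q\<close>, so \<open>x - q \<ge> q\<close> and
            \<open>q\<close> cancels in \<open>yx\<close>.\<close>
          have B: "y \<le> d - e - 1"
          proof (cases "e = d - 1")
            case True
            then have "x - a - 1 = 0" by (simp add: e_def a)
            with yx have "y * (x - q) \<le> 0" by simp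
            then show ?thesis using 3 nonneg True by (simp add: mult_le_0_iff)
          next
            case False
            with e have xa2: "a + 2 \<le> x" by (simp add: e_def a)
            have "y * q \<le> y * (x - q)" using xa2 aq nonneg by (intro mult_left_mono) auto
            with yx have "y * q \<le> (x - a - 1) * q" by (simp add: mult.commute)
            then show ?thesis using q2 by (simp add: e_def a)
          qed
          \<comment> \<open>The product equals \<open>d(d - 1) - e(e + 1) - 2(d - e - 1)\<close>,
            the slack left after inserting \<open>A\<close> and \<open>B\<close>.\<close>
          have "0 \<le> (d + e - 2) * (d - e - 1)" if "e \<noteq> d - 1"
            using e that by (intro mult_nonneg_nonneg) auto
          then have "0 \<le> (d + e - 2) * (d - e - 1)" by fastforce
          then show ?thesis using A B by (simp add: algebra_simps)
        qed
        with m show ?thesis by linarith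
      qed
      finally show ?thesis by (intro done_if) simp
    qed
  qed (rule done_if)
qed

section \<open>Incidence counts in a unital\<close>

lemma card_inter_eq_sum:
  "finite X \<Longrightarrow> int (card (B \<inter> X)) = (\<Sum>p\<in>X. of_bool (p \<in> B))"
proof -
  assume "finite X"
  moreover have "X \<inter> {p. p \<in> B} = B \<inter> X" by auto
  ultimately show ?thesis by (simp add: sum.If_cases of_bool_def)
qed

locale unital_design =
  fixes n :: nat and P :: "'a set" and Bs :: "'a set set"
  assumes unital: "unital n P Bs"
begin

abbreviation meeting :: "'a set \<Rightarrow> 'a set set" where
  "meeting X \<equiv> {B \<in> Bs. B \<inter> X \<noteq> {}}"

lemma n_ge_2: "n \<ge> 2"
  and finite_P: "finite P"
  and card_P: "card P = n ^ 3 + 1"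
  and block_subset: "B \<in> Bs \<Longrightarrow> B \<subseteq> P"
  and card_block: "B \<in> Bs \<Longrightarrow> card B = n + 1"
  using unital unfolding unital_def two_design_def by (elim conjE, blast)+

lemma finite_Bs: "finite Bs"
  by (rule finite_subset[of _ "Pow P"]) (auto simp: finite_P dest: block_subset)

lemma finite_block: "B \<in> Bs \<Longrightarrow> finite B"
  by (rule finite_subset[OF block_subset finite_P])

lemma card_blocks_through:
  assumes "p \<in> P" "r \<in> P" "p \<noteq> r"
  shows "card {B \<in> Bs. p \<in> B \<and> r \<in> B} = 1"
proof -
  have "{p, r} \<subseteq> P" "card {p, r} = 2" using assms by auto
  then have "card {B \<in> Bs. {p, r} \<subseteq> B} = 1"
    using unital unfolding unital_def two_design_def by blast
  then show ?thesis by simp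
qed

lemma block_unique:
  assumes "B \<in> Bs" "C \<in> Bs" "p \<in> B" "r \<in> B" "p \<in> C" "r \<in> C" "p \<noteq> r"
  shows "B = C"
proof -
  have "card {B \<in> Bs. p \<in> B \<and> r \<in> B} = 1"
    using assms block_subset by (intro card_blocks_through) auto
  then obtain D where "{B \<in> Bs. p \<in> B \<and> r \<in> B} = {D}" by (rule card_1_singletonE)
  moreover have "B \<in> {B \<in> Bs. p \<in> B \<and> r \<in> B}" "C \<in> {B \<in> Bs. p \<in> B \<and> r \<in> B}"
    using assms by simp_all
  ultimately show ?thesis by simp
qed

text \<open>Double counting of triples (p, r, B) with p in \<open>B \<inter> X\<close> and r in
  \<open>B \<inter> Y\<close>. The sets may overlap: \<open>X = Y\<close> yields second moments,
  disjoint sets yield cross terms.\<close>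

lemma sum_inter_mult:
  assumes "finite X" "finite Y"
  shows "(\<Sum>B\<in>Bs. int (card (B \<inter> X)) * int (card (B \<inter> Y)))
    = (\<Sum>p\<in>X. \<Sum>r\<in>Y. int (card {B \<in> Bs. p \<in> B \<and> r \<in> B}))"
proof -
  have "(\<Sum>B\<in>Bs. int (card (B \<inter> X)) * int (card (B \<inter> Y)))
      = (\<Sum>B\<in>Bs. \<Sum>p\<in>X. \<Sum>r\<in>Y. of_bool (p \<in> B \<and> r \<in> B))"
    using assms by (simp only: card_inter_eq_sum sum_product of_bool_conj)
  also have "\<dots> = (\<Sum>p\<in>X. \<Sum>r\<in>Y. \<Sum>B\<in>Bs. of_bool (p \<in> B \<and> r \<in> B))"
    by (subst sum.swap, rule sum.cong[OF refl], subst sum.swap, rule refl)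
  also have "\<dots> = (\<Sum>p\<in>X. \<Sum>r\<in>Y. int (card {B \<in> Bs. p \<in> B \<and> r \<in> B}))"
    using finite_Bs by (simp add: of_bool_def sum.If_cases Int_def)
  finally show ?thesis .
qed

text \<open>Each of the \<open>n^3\<close> other points is joined to \<open>p\<close> by one line,
  and each line through \<open>p\<close> contains \<open>n\<close> of them.\<close>

lemma card_blocks_at:
  assumes "p \<in> P"
  shows "card {B \<in> Bs. p \<in> B} = n ^ 2"
proof -
  have "(\<Sum>B\<in>Bs. int (card (B \<inter> {p})) * int (card (B \<inter> (P - {p}))))
      = (\<Sum>r\<in>{p}. \<Sum>s\<in>P - {p}. int (card {B \<in> Bs. r \<in> B \<and> s \<in> B}))"
    using finite_P by (intro sum_inter_mult) auto
  also have "\<dots> = (\<Sum>s\<in>P - {p}. int (card {B \<in> Bs. p \<in> B \<and> s \<in> B}))"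
    by simp
  also have "\<dots> = (\<Sum>s\<in>P - {p}. 1)"
    using assms by (intro sum.cong refl) (subst card_blocks_through, auto)
  also have "\<dots> = int n ^ 3"
    using card_P finite_P assms by simp
  also have "(\<Sum>B\<in>Bs. int (card (B \<inter> {p})) * int (card (B \<inter> (P - {p}))))
      = (\<Sum>B\<in>Bs. if p \<in> B then int n else 0)"
  proof (rule sum.cong[OF refl])
    fix B assume B: "B \<in> Bs"
    have "B \<inter> (P - {p}) = B - {p}" using block_subset[OF B] by auto
    then show "int (card (B \<inter> {p})) * int (card (B \<inter> (P - {p}))) = (if p \<in> B then int n else 0)"
      using card_block[OF B] finite_block[OF B] by auto
  qed
  also have "\<dots> = int (card {B \<in> Bs. p \<in> B}) * int n"
    using finite_Bs by (simp add: sum.If_cases Int_def)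
  finally have "int (card {B \<in> Bs. p \<in> B}) * int n = int n ^ 2 * int n"
    by (simp add: power2_eq_square power3_eq_cube)
  then have "int (card {B \<in> Bs. p \<in> B}) = int (n ^ 2)" using n_ge_2 by simp
  then show ?thesis by (simp only: of_nat_eq_iff)
qed

lemma sum_inter_mult_disjoint:
  assumes "X \<subseteq> P" "Y \<subseteq> P" "X \<inter> Y = {}"
  shows "(\<Sum>B\<in>Bs. int (card (B \<inter> X)) * int (card (B \<inter> Y))) = int (card X) * int (card Y)"
proof -
  have fin: "finite X" "finite Y" using assms finite_P by (auto intro: finite_subset)
  have "(\<Sum>p\<in>X. \<Sum>r\<in>Y. int (card {B \<in> Bs. p \<in> B \<and> r \<in> B})) = (\<Sum>p\<in>X. \<Sum>r\<in>Y. 1)"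
    using assms by (intro sum.cong refl) (subst card_blocks_through, auto)
  then show ?thesis by (simp add: sum_inter_mult fin)
qed

lemma sum_inter:
  assumes "X \<subseteq> P"
  shows "(\<Sum>B\<in>Bs. int (card (B \<inter> X))) = int n ^ 2 * int (card X)"
proof -
  have fin: "finite X" using assms finite_P finite_subset by auto
  have "(\<Sum>B\<in>Bs. int (card (B \<inter> X))) = (\<Sum>p\<in>X. \<Sum>B\<in>Bs. of_bool (p \<in> B))"
    by (simp only: card_inter_eq_sum fin) (rule sum.swap)
  also have "\<dots> = (\<Sum>p\<in>X. int (card {B \<in> Bs. p \<in> B}))"
    using finite_Bs by (simp add: of_bool_def sum.If_cases Int_def)
  also have "\<dots> = (\<Sum>p\<in>X. int n ^ 2)"
    using assms by (intro sum.cong refl) (subst card_blocks_at, auto)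
  finally show ?thesis by simp
qed

text \<open>Among ordered pairs from \<open>X\<close>, a diagonal pair lies on \<open>n^2\<close>
  lines and any other pair on one.\<close>

lemma sum_inter_square:
  assumes "X \<subseteq> P"
  shows "(\<Sum>B\<in>Bs. int (card (B \<inter> X)) ^ 2) = int (card X) * (int n ^ 2 + int (card X) - 1)"
proof -
  have fin: "finite X" using assms finite_P finite_subset by auto
  have "(\<Sum>r\<in>X. int (card {B \<in> Bs. p \<in> B \<and> r \<in> B})) = int n ^ 2 + int (card X) - 1"
    if "p \<in> X" for p
  proof -
    have "(\<Sum>r\<in>X. int (card {B \<in> Bs. p \<in> B \<and> r \<in> B}))
        = int (card {B \<in> Bs. p \<in> B}) + (\<Sum>r\<in>X - {p}. int (card {B \<in> Bs. p \<in> B \<and> r \<in> B}))"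
      using sum.remove[OF fin that, of "\<lambda>r. int (card {B \<in> Bs. p \<in> B \<and> r \<in> B})"] by simp
    also have "(\<Sum>r\<in>X - {p}. int (card {B \<in> Bs. p \<in> B \<and> r \<in> B})) = (\<Sum>r\<in>X - {p}. 1)"
      using assms that by (intro sum.cong refl) (subst card_blocks_through, auto)
    also have "\<dots> = int (card (X - {p}))" by simp
    also have "\<dots> = int (card X) - 1"
      using card_Suc_Diff1[OF fin that] by linarith
    finally show ?thesis using assms that card_blocks_at by auto
  qed
  then show ?thesis by (simp add: power2_eq_square sum_inter_mult fin)
qed

text \<open>Counting flags gives \<open>card Bs * (n + 1) = n^2 (n^3 + 1)\<close>, and
  \<open>n + 1\<close> divides \<open>n^3 + 1\<close>.\<close>

lemma card_Bs: "int (card Bs) = int n ^ 2 * (int n ^ 2 - int n + 1)"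
proof -
  have "(\<Sum>B\<in>Bs. int (card (B \<inter> P))) = (\<Sum>B\<in>Bs. int n + 1)"
    using block_subset card_block by (intro sum.cong refl) (simp add: Int_absorb2)
  then have "int (card Bs) * (int n + 1) = int n ^ 2 * (int n ^ 3 + 1)"
    using sum_inter[of P] by (simp add: card_P add.commute)
  also have "\<dots> = int n ^ 2 * (int n ^ 2 - int n + 1) * (int n + 1)" by algebra
  finally show ?thesis by (simp add: mult_right_cancel)
qed

section \<open>Numbers of lines meeting or missing point sets\<close>

lemma meeting_eq_sum:
  "int (card (meeting X)) = (\<Sum>B\<in>Bs. if B \<inter> X = {} then 0 else 1)"
proof -
  have "int (card (meeting X)) = (\<Sum>B\<in>meeting X. if B \<inter> X = {} then 0 else 1)" by simp
  also have "\<dots> = (\<Sum>B\<in>Bs. if B \<inter> X = {} then 0 else 1)"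
    using finite_Bs by (intro sum.mono_neutral_left) auto
  finally show ?thesis .
qed

text \<open>For an integer $c \ge 0$ we have $3c - c^2 \le 2$, with equality iff $c \in \{1, 2\}$; at
  $c = 0$ the left-hand side is $0$. So $3c - c^2$ is at most twice the indicator of $c > 0$.\<close>

lemma sum_secants:
  assumes "X \<subseteq> P"
  shows "(\<Sum>B\<in>Bs. 3 * int (card (B \<inter> X)) - int (card (B \<inter> X)) ^ 2)
    = 2 * int n ^ 2 * int (card X) - int (card X) * (int (card X) - 1)"
  using sum_inter[OF assms] sum_inter_square[OF assms]
  by (simp add: sum_subtractf flip: sum_distrib_left) (simp add: algebra_simps)

lemma meeting_lower_bound:
  assumes "X \<subseteq> P"
  shows "2 * int n ^ 2 * int (card X) - int (card X) * (int (card X) - 1) \<le> 2 * int (card (meeting X))"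
proof -
  have "(\<Sum>B\<in>Bs. 3 * int (card (B \<inter> X)) - int (card (B \<inter> X)) ^ 2)
      \<le> (\<Sum>B\<in>Bs. 2 * (if B \<inter> X = {} then 0 else 1))"
  proof (rule sum_mono)
    fix B
    define c where "c = int (card (B \<inter> X))"
    \<comment> \<open>No integer lies strictly between 1 and 2.\<close>
    have "0 \<le> (c - 1) * (c - 2)"
      by (cases "c \<le> 1") (auto intro: mult_nonneg_nonneg mult_nonpos_nonpos)
    then have "3 * c - c ^ 2 \<le> 2" by (simp add: algebra_simps power2_eq_square)
    then show "3 * int (card (B \<inter> X)) - int (card (B \<inter> X)) ^ 2 \<le> 2 * (if B \<inter> X = {} then 0 else 1)"
      by (auto simp: c_def)
  qed
  then show ?thesis
    unfolding sum_secants[OF assms] meeting_eq_sum sum_distrib_left .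
qed

lemma meeting_arc:
  assumes "X \<subseteq> P" and arc: "\<And>B. B \<in> Bs \<Longrightarrow> card (B \<inter> X) \<le> 2"
  shows "2 * int (card (meeting X)) = 2 * int n ^ 2 * int (card X) - int (card X) * (int (card X) - 1)"
proof -
  have fin: "finite X" using assms finite_P finite_subset by auto
  have "(\<Sum>B\<in>Bs. 3 * int (card (B \<inter> X)) - int (card (B \<inter> X)) ^ 2)
      = (\<Sum>B\<in>Bs. 2 * (if B \<inter> X = {} then 0 else 1))"
  proof (rule sum.cong[OF refl])
    fix B assume "B \<in> Bs"
    with arc have "card (B \<inter> X) \<in> {0, 1, 2}" by force
    then show "3 * int (card (B \<inter> X)) - int (card (B \<inter> X)) ^ 2 = 2 * (if B \<inter> X = {} then 0 else 1)"
      using fin by auto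
  qed
  then show ?thesis
    unfolding sum_secants[OF assms(1)] meeting_eq_sum sum_distrib_left by simp
qed

text \<open>Cauchy-Schwarz for the intersection sizes over the lines meeting \<open>Y\<close>, with
  first and second moments known; one factor \<open>card Y\<close> cancels. Unlike the quadratic
  bound \<open>meeting_lower_bound\<close>, it stays useful for large \<open>Y\<close>.\<close>

lemma meeting_Cauchy_Schwarz:
  assumes "Y \<subseteq> P"
  shows "int n ^ 4 * int (card Y) \<le> int (card (meeting Y)) * (int n ^ 2 + int (card Y) - 1)"
proof (cases "Y = {}")
  case False
  have fin: "finite Y" using assms finite_P finite_subset by auto
  with False have y: "int (card Y) > 0" by (simp add: card_gt_0_iff)
  define c where "c B = real (card (B \<inter> Y))" for B
  have "(\<Sum>B\<in>meeting Y. c B) = (\<Sum>B\<in>Bs. c B)" "(\<Sum>B\<in>meeting Y. c B ^ 2) = (\<Sum>B\<in>Bs. c B ^ 2)"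
    using finite_Bs by (auto intro!: sum.mono_neutral_left simp: c_def)
  moreover have "(\<Sum>B\<in>Bs. c B) = real_of_int (int n ^ 2 * int (card Y))"
    unfolding sum_inter[OF assms, symmetric] by (simp add: c_def)
  moreover have "(\<Sum>B\<in>Bs. c B ^ 2) = real_of_int (int (card Y) * (int n ^ 2 + int (card Y) - 1))"
    unfolding sum_inter_square[OF assms, symmetric] by (simp add: c_def)
  moreover have "(\<Sum>B\<in>meeting Y. c B) ^ 2 \<le> (\<Sum>B\<in>meeting Y. c B ^ 2) * real (card (meeting Y))"
    by (rule sum_squared_le_sum_of_squares)
  ultimately have "real_of_int ((int n ^ 2 * int (card Y)) ^ 2)
      \<le> real_of_int ((int (card Y) * (int n ^ 2 + int (card Y) - 1)) * int (card (meeting Y)))"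
    by simp
  then have "(int n ^ 2 * int (card Y)) ^ 2
      \<le> (int (card Y) * (int n ^ 2 + int (card Y) - 1)) * int (card (meeting Y))"
    by (simp only: of_int_le_iff)
  then have "int (card Y) * (int n ^ 4 * int (card Y))
      \<le> int (card Y) * (int (card (meeting Y)) * (int n ^ 2 + int (card Y) - 1))"
    by (simp add: algebra_simps power2_eq_square power4_eq_xxxx)
  then show ?thesis using y by simp
qed simp

text \<open>The lines of \<open>L\<close> are among those not counted by \<open>meeting Y\<close>;
  with the value of \<open>card Bs\<close>, the Cauchy-Schwarz bound factors into this form.\<close>

lemma missing_lines_bound:
  assumes "Y \<subseteq> P" "L \<subseteq> Bs" "\<And>B. B \<in> L \<Longrightarrow> B \<inter> Y = {}"
  shows "int (card L) * (int n ^ 2 + int (card Y) - 1)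
    \<le> int n ^ 2 * (int n - 1) * (int n ^ 3 + 1 - int (card Y))"
proof -
  have "card L + card (meeting Y) = card (L \<union> meeting Y)"
    using assms finite_Bs by (intro card_Un_disjoint[symmetric]) (auto intro: finite_subset)
  also have "\<dots> \<le> card Bs" using assms finite_Bs by (intro card_mono) auto
  finally have "int (card L) \<le> int (card Bs) - int (card (meeting Y))" by linarith
  moreover have "0 \<le> int n ^ 2 + int (card Y) - 1"
    using n_ge_2 one_le_power[of "int n" 2] by linarith
  ultimately have "int (card L) * (int n ^ 2 + int (card Y) - 1)
      \<le> (int (card Bs) - int (card (meeting Y))) * (int n ^ 2 + int (card Y) - 1)"
    by (intro mult_right_mono)
  also have "\<dots> \<le> int (card Bs) * (int n ^ 2 + int (card Y) - 1) - int n ^ 4 * int (card Y)"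
    using meeting_Cauchy_Schwarz[OF assms(1)] by (simp add: left_diff_distrib)
  also have "\<dots> = int n ^ 2 * (int n - 1) * (int n ^ 3 + 1 - int (card Y))"
    unfolding card_Bs by algebra
  finally show ?thesis .
qed

text \<open>Each pair in \<open>X \<times> Y\<close> lies on one line, and a line with
  \<open>i\<close> points in \<open>X\<close> and \<open>j\<close> in \<open>Y\<close> carries
  \<open>ij\<close> pairs, where \<open>i + j \<le> n + 1\<close>.\<close>

lemma cross_bound:
  assumes "X \<subseteq> P" "Y \<subseteq> P" "X \<inter> Y = {}"
  shows "int (card X) * int (card Y)
    \<le> (int n + 1) ^ 2 div 4 * int (card (meeting X \<inter> meeting Y))"
proof -
  have fin: "finite X" "finite Y" using assms finite_P by (auto intro: finite_subset)
  have "(\<Sum>B\<in>Bs. int (card (B \<inter> X)) * int (card (B \<inter> Y)))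
      = (\<Sum>B\<in>meeting X \<inter> meeting Y. int (card (B \<inter> X)) * int (card (B \<inter> Y)))"
    using finite_Bs by (intro sum.mono_neutral_right) auto
  also have "\<dots> \<le> (\<Sum>B\<in>meeting X \<inter> meeting Y. (int n + 1) ^ 2 div 4)"
  proof (rule sum_mono)
    fix B assume "B \<in> meeting X \<inter> meeting Y"
    then have B: "B \<in> Bs" by auto
    define i j where "i = int (card (B \<inter> X))" and "j = int (card (B \<inter> Y))"
    have "card (B \<inter> X) + card (B \<inter> Y) = card (B \<inter> X \<union> B \<inter> Y)"
      using assms fin by (intro card_Un_disjoint[symmetric]) auto
    also have "\<dots> \<le> card B" using finite_block[OF B] by (intro card_mono) auto
    finally have "i + j \<le> int n + 1" using card_block[OF B] by (simp add: i_def j_def)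
    then have "(i + j) ^ 2 \<le> (int n + 1) ^ 2" by (intro power_mono) (auto simp: i_def j_def)
    moreover have "4 * (i * j) = (i + j) ^ 2 - (i - j) ^ 2" by algebra
    ultimately have "4 * (i * j) \<le> (int n + 1) ^ 2" by (smt (verit) zero_le_power2)
    then show "int (card (B \<inter> X)) * int (card (B \<inter> Y)) \<le> (int n + 1) ^ 2 div 4"
      unfolding i_def j_def by linarith
  qed
  finally show ?thesis
    by (simp add: sum_inter_mult_disjoint[OF assms] mult.commute)
qed

section \<open>Existence of arcs and of a maximum arc\<close>

lemma ex_arc: "\<exists>A. is_arc P Bs 3 A"
proof -
  have "8 \<le> n ^ 3" using power_mono[OF n_ge_2, of 3] by simp
  then obtain p r where pr: "p \<in> P" "r \<in> P" "p \<noteq> r"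
    using card_P finite_P by (metis add_leD2 card_le_Suc0_iff_eq le_numeral_extra(4) One_nat_def Suc_eq_plus1 not_less_eq_eq numeral_le_one_iff not_numeral_le_zero semiring_norm(69) le_zero_eq)
  then obtain B where B: "B \<in> Bs" "p \<in> B" "r \<in> B"
    using card_blocks_through[OF pr] by (metis (no_types, lifting) One_nat_def card.empty empty_Collect_eq nat.distinct(1))
  \<comment> \<open>A line has \<open>n + 1 < n^3 + 1\<close> points, so some point lies off
    it.\<close>
  have "n < n ^ 3" using n_ge_2 by (simp add: power_strict_increasing[of 1 3 n, simplified])
  then have "\<not> P \<subseteq> B"
    using card_mono[OF finite_block[OF B(1)], of P] card_block[OF B(1)] card_P by auto
  then obtain s where s: "s \<in> P" "s \<notin> B" by auto
  have "is_arc P Bs 3 {p, r, s}"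
    unfolding is_arc_def
  proof (intro conjI notI; (elim exE conjE)?)
    have "p \<noteq> s" "r \<noteq> s" using s B by auto
    with pr show c3: "card {p, r, s} = 3" by simp
    fix T C assume T: "T \<subseteq> {p, r, s}" "card T = 3" and C: "C \<in> Bs" "T \<subseteq> C"
    have "T = {p, r, s}" using T c3 by (intro card_subset_eq) auto
    then have "B = C" using B C pr by (intro block_unique[of B C p r]) auto
    then show False using s C \<open>T = {p, r, s}\<close> by auto
  qed (use pr s in auto)
  then show ?thesis ..
qed

lemma max_arc: "\<exists>A. is_arc P Bs (max_arc_size P Bs) A"
proof -
  have "{k. \<exists>A. is_arc P Bs k A} \<subseteq> {.. card P}"
    using finite_P by (auto simp: is_arc_def card_mono)
  then have fin: "finite {k. \<exists>A. is_arc P Bs k A}" by (rule finite_subset) simp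
  have "{k. \<exists>A. is_arc P Bs k A} \<noteq> {}" using ex_arc by auto
  from Max_in[OF fin this] show ?thesis
    unfolding max_arc_size_def by simp
qed

section \<open>Expansion in the incidence graph\<close>

text \<open>The number of vertices is odd, so an admissible set has at most
  \<open>n^2(n^2 + 1)/2\<close> elements.\<close>

lemma card_verts: "int (card (P <+> Bs)) = int n ^ 2 * (int n ^ 2 + 1) + 1"
proof -
  have "int (card (P <+> Bs)) = int n ^ 3 + 1 + int (card Bs)"
    using finite_P finite_Bs by (simp add: card_Plus card_P)
  then show ?thesis unfolding card_Bs by (simp add: algebra_simps power2_eq_square power3_eq_cube)
qed

lemma nbhd_incidence_graph:
  assumes "X \<subseteq> P" "L \<subseteq> Bs"
  shows "nbhd (incidence_graph P Bs) (X <+> L) = {p \<in> P - X. \<exists>B\<in>L. p \<in> B} <+> (meeting X - L)"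
proof (rule set_eqI)
  fix z
  have bex: "(\<exists>u\<in>X <+> L. Q u) \<longleftrightarrow> (\<exists>p\<in>X. Q (Inl p)) \<or> (\<exists>B\<in>L. Q (Inr B))" for Q
    by (auto simp: Plus_def)
  show "z \<in> nbhd (incidence_graph P Bs) (X <+> L)
    \<longleftrightarrow> z \<in> {p \<in> P - X. \<exists>B\<in>L. p \<in> B} <+> (meeting X - L)"
    using assms unfolding nbhd_def mem_Collect_eq bex
    by (cases z) (fastforce simp: incidence_graph_def)+
qed

lemma expansion_lower_bound:
  assumes "S \<subseteq> P <+> Bs" "2 * int (card S) \<le> int (card (P <+> Bs))"
  shows "2 * (int n ^ 3 + 1 - \<lfloor>unital_c n\<rfloor>) * int (card S)
    \<le> int n ^ 2 * (int n ^ 2 + 1) * int (card (nbhd (incidence_graph P Bs) S))"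
proof -
  define X where "X = {p. Inl p \<in> S}"
  define L where "L = {B. Inr B \<in> S}"
  define Y where "Y = {p \<in> P - X. \<forall>B\<in>L. p \<notin> B}"
  define K where "K = meeting X - L"
  have S: "S = X <+> L"
  proof (rule set_eqI)
    fix z show "z \<in> S \<longleftrightarrow> z \<in> X <+> L" by (cases z) (auto simp: X_def L_def)
  qed
  have XL: "X \<subseteq> P" "L \<subseteq> Bs" using assms(1) unfolding S by auto
  have YP: "Y \<subseteq> P" and XY: "X \<inter> Y = {}" by (auto simp: Y_def)
  have fin: "finite X" "finite L" "finite Y" "finite K"
    using XL YP finite_P finite_Bs by (auto intro: finite_subset simp: K_def)
  obtain d :: int where d: "\<lfloor>unital_c n\<rfloor> = int n ^ 2 - d" "d \<ge> 1"
    "2 * int n ^ 2 \<le> d * (d + 3)" "(d - 1) * (d + 2) < 2 * int n ^ 2" "2 * d \<le> 3 * int n"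
    using unital_c_floor[OF n_ge_2] .
  have cS: "int (card S) = int (card X) + int (card L)"
    unfolding S using fin by (simp add: card_Plus)
  have "card {p \<in> P - X. \<exists>B\<in>L. p \<in> B} = card (P - (X \<union> Y))"
    by (rule arg_cong[of _ _ card]) (auto simp: Y_def)
  also have "int \<dots> = int n ^ 3 + 1 - int (card X) - int (card Y)"
    using XL YP XY fin finite_P card_mono[of P "X \<union> Y"]
    by (simp add: card_Diff_subset card_Un_disjoint card_P of_nat_diff)
  finally have cN: "int (card (nbhd (incidence_graph P Bs) S))
      = int n ^ 3 + 1 - int (card X) - int (card Y) + int (card K)"
    unfolding S nbhd_incidence_graph[OF XL] K_def[symmetric]
    using fin finite_P by (simp add: card_Plus)
  \<comment> \<open>No line of \<open>L\<close> meets \<open>Y\<close>, by the choice of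
    \<open>Y\<close>.\<close>
  have "meeting X \<inter> meeting Y \<subseteq> K" by (auto simp: K_def Y_def)
  then have "int (card (meeting X \<inter> meeting Y)) \<le> int (card K)"
    using fin by (simp add: card_mono)
  then have "(int n + 1) ^ 2 div 4 * int (card (meeting X \<inter> meeting Y)) \<le> (int n + 1) ^ 2 div 4 * int (card K)"
    by (intro mult_left_mono) (auto simp: pos_imp_zdiv_nonneg_iff)
  with cross_bound[OF XL(1) YP XY]
  have cross: "int (card X) * int (card Y) \<le> (int n + 1) ^ 2 div 4 * int (card K)" by linarith
  have meet: "2 * int n ^ 2 * j - j * (j - 1) \<le> 2 * (int (card L) + int (card K))"
    if j: "0 \<le> j" "j \<le> int (card X)" for j
  proof -
    from j have "nat j \<le> card X" by linarith
    then obtain Z where Z: "Z \<subseteq> X" "card Z = nat j"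
      by (meson obtain_subset_with_card_n)
    have "meeting Z \<subseteq> L \<union> K" using Z XL by (auto simp: K_def)
    then have "card (meeting Z) \<le> card (L \<union> K)" using fin by (intro card_mono) auto
    also have "\<dots> \<le> card L + card K" by (rule card_Un_le)
    finally have "int (card (meeting Z)) \<le> int (card L) + int (card K)" by linarith
    moreover have "Z \<subseteq> P" using Z XL by blast
    ultimately show ?thesis
      using meeting_lower_bound[of Z] Z j by (simp add: distrib_left)
  qed
  have miss: "int (card L) * (int n ^ 2 + int (card Y) - 1)
    \<le> int n ^ 2 * (int n - 1) * (int n ^ 3 + 1 - int (card Y))"
    using YP XL by (intro missing_lines_bound) (auto simp: Y_def)
  have half: "2 * (int (card X) + int (card L)) \<le> int n ^ 2 * (int n ^ 2 + 1)"
  proof -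
    have "even (int n ^ 2 * (int n ^ 2 + 1))" by simp
    then obtain j where j: "int n ^ 2 * (int n ^ 2 + 1) = 2 * j" by (rule evenE)
    show ?thesis using assms(2) unfolding cS card_verts j by presburger
  qed
  show ?thesis
    unfolding cN cS
    by (rule expansion_arithmetic[OF _ refl d(1) d(2,4,5) refl _ _ _ _ half cross meet miss])
      (use n_ge_2 in auto)
qed

text \<open>Any \<open>k\<close> points of a maximum arc serve, since only the bound of two points
  per line is inherited and used; so \<open>k\<close> may be smaller than the arc.\<close>

lemma expansion_upper_bound:
  assumes k: "k \<le> max_arc_size P Bs" "int k \<le> \<lfloor>unital_c n\<rfloor>"
  obtains S where "S \<subseteq> P <+> Bs" "2 * int (card S) = int n ^ 2 * (int n ^ 2 + 1)"
    "int (card (nbhd (incidence_graph P Bs) S)) \<le> int n ^ 3 + 1 - int k"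
proof -
  obtain A where A: "is_arc P Bs (max_arc_size P Bs) A" using max_arc by blast
  then obtain X where X: "X \<subseteq> A" "card X = k"
    using k(1) unfolding is_arc_def by (metis obtain_subset_with_card_n)
  have XP: "X \<subseteq> P" using X A by (auto simp: is_arc_def)
  have fin: "finite X" using XP finite_P finite_subset by auto
  have "card (B \<inter> X) \<le> 2" if "B \<in> Bs" for B
  proof (rule ccontr)
    assume "\<not> ?thesis"
    then obtain T where "T \<subseteq> B \<inter> X" "card T = 3"
      by (metis not_less_eq_eq numeral_2_eq_2 numeral_3_eq_3 obtain_subset_with_card_n)
    then show False using A X that unfolding is_arc_def by blast
  qed
  then have cm: "2 * int (card (meeting X)) = 2 * int n ^ 2 * int k - int k * (int k - 1)"
    using meeting_arc[OF XP] X by auto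
  obtain d :: int where d: "\<lfloor>unital_c n\<rfloor> = int n ^ 2 - d" "d \<ge> 1"
    "2 * int n ^ 2 \<le> d * (d + 3)"
    using unital_c_floor[OF n_ge_2] by metis
  \<comment> \<open>In terms of \<open>e\<close>, the condition
    \<open>card (meeting X) + k \<le> h\<close> becomes \<open>e(e + 3) \<ge> 2n^2\<close>, which
    holds from \<open>e = d\<close> on.\<close>
  define e where "e = int n ^ 2 - int k"
  have "d \<le> e" using k(2) d by (simp add: e_def)
  then have "d * (d + 3) \<le> e * (e + 3)" using d by (intro mult_mono) auto
  with d have e: "2 * int n ^ 2 \<le> e * (e + 3)" by linarith
  define h where "h = n ^ 2 * (n ^ 2 + 1) div 2"
  have "2 * h = n ^ 2 * (n ^ 2 + 1)" unfolding h_def by simp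
  then have h: "2 * int h = int n ^ 2 * (int n ^ 2 + 1)"
    by (metis (no_types, lifting) of_nat_1 of_nat_add of_nat_mult of_nat_numeral of_nat_power)
  have "2 * (int (card (meeting X)) + int k) = int n ^ 2 * (int n ^ 2 + 1) + 2 * int n ^ 2 - e * (e + 3)"
    using cm unfolding e_def by algebra
  then have mk: "card (meeting X) + k \<le> h" using e h by presburger
  \<comment> \<open>There are at least \<open>h\<close> lines in total, so \<open>meeting X\<close>
    can be enlarged to \<open>h - k\<close> lines.\<close>
  have "2 * int (card Bs) = 2 * int h + (int n * (int n - 1)) ^ 2"
    unfolding card_Bs h by algebra
  then have "h - k \<le> card Bs" by (smt (verit) of_nat_le_iff diff_le_self le_trans zero_le_power2)
  then obtain L where L: "meeting X \<subseteq> L" "L \<subseteq> Bs" "card L = h - k"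
    using exists_subset_between[of "meeting X" "h - k" Bs] mk finite_Bs
    by (metis (no_types, lifting) add_le_imp_le_diff mem_Collect_eq subsetI)
  have finL: "finite L" using L finite_Bs by (auto intro: finite_subset)
  show thesis
  proof (rule that[of "X <+> L"])
    show "X <+> L \<subseteq> P <+> Bs" using XP L by auto
    have "card (X <+> L) = h" using fin finL X L mk by (simp add: card_Plus)
    then show "2 * int (card (X <+> L)) = int n ^ 2 * (int n ^ 2 + 1)" using h by simp
    \<comment> \<open>All neighbours are now points outside \<open>X\<close>.\<close>
    have "meeting X - L = {}" using L by blast
    then have "nbhd (incidence_graph P Bs) (X <+> L) \<subseteq> Inl ` (P - X)"
      unfolding nbhd_incidence_graph[OF XP L(2)] by (auto simp: Plus_def)
    then have "card (nbhd (incidence_graph P Bs) (X <+> L)) \<le> card (P - X)"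
      using finite_P by (intro surj_card_le) auto
    also have "int \<dots> = int n ^ 3 + 1 - int k"
      using fin XP X card_mono[OF finite_P XP] by (simp add: card_Diff_subset card_P of_nat_diff)
    finally show "int (card (nbhd (incidence_graph P Bs) (X <+> L))) \<le> int n ^ 3 + 1 - int k" by simp
  qed
qed

end

section \<open>From integer inequalities to the isoperimetric number\<close>

theorem theorem1p1:
  fixes n :: nat and P :: "'a set" and Bs :: "'a set set"
  assumes "unital n P Bs"
  shows "2 * (real n ^ 3 + 1 - real_of_int \<lfloor>unital_c n\<rfloor>) / (real n ^ 2 * (real n ^ 2 + 1))
           \<le> vertex_isoperimetric_number (incidence_graph P Bs)
       \<and> vertex_isoperimetric_number (incidence_graph P Bs)
           \<le> 2 * (real n ^ 3 + 1 - real_of_int (min (int (max_arc_size P Bs)) \<lfloor>unital_c n\<rfloor>))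
               / (real n ^ 2 * (real n ^ 2 + 1))"
proof -
  interpret unital_design n P Bs by (rule unital_design.intro) fact
  let ?G = "incidence_graph P Bs"
  define \<S> where "\<S> = {S. S \<subseteq> P <+> Bs \<and> S \<noteq> {} \<and> real (card S) \<le> real (card (P <+> Bs)) / 2}"
  define f where "f S = real (card (nbhd ?G S)) / real (card S)" for S
  have iso: "vertex_isoperimetric_number ?G = Min (f ` \<S>)"
    unfolding vertex_isoperimetric_number_def \<S>_def f_def
    by (rule arg_cong[of _ _ Min]) (auto simp: incidence_graph_def)
  have finV: "finite (P <+> Bs)" using finite_P finite_Bs by simp
  then have fin: "finite \<S>" unfolding \<S>_def by simp
  have pos: "real n ^ 2 * (real n ^ 2 + 1) > 0"
    using n_ge_2 by (intro mult_pos_pos add_pos_nonneg) auto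
  obtain d :: int where d: "\<lfloor>unital_c n\<rfloor> = int n ^ 2 - d" "2 * d \<le> 3 * int n"
    using unital_c_floor[OF n_ge_2] by metis
  \<comment> \<open>The floor is at least \<open>n^2 - 3n/2\<close>, hence nonnegative, so
    \<open>nat\<close> in the definition of \<open>k\<close> truncates nothing.\<close>
  have "2 * int n \<le> int n * int n" using n_ge_2 by (intro mult_right_mono) auto
  then have c0: "\<lfloor>unital_c n\<rfloor> \<ge> 0" using d by (simp add: power2_eq_square)
  define k where "k = nat (min (int (max_arc_size P Bs)) \<lfloor>unital_c n\<rfloor>)"
  have k: "k \<le> max_arc_size P Bs" "int k \<le> \<lfloor>unital_c n\<rfloor>"
    "min (int (max_arc_size P Bs)) \<lfloor>unital_c n\<rfloor> = int k"
    using c0 by (auto simp: k_def)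
  obtain S where S: "S \<subseteq> P <+> Bs" "2 * int (card S) = int n ^ 2 * (int n ^ 2 + 1)"
    "int (card (nbhd ?G S)) \<le> int n ^ 3 + 1 - int k"
    using expansion_upper_bound[OF k(1,2)] .
  have "real_of_int (2 * int (card S)) = real_of_int (int n ^ 2 * (int n ^ 2 + 1))"
    unfolding S(2) ..
  then have cS: "real (card S) = real n ^ 2 * (real n ^ 2 + 1) / 2" by simp
  have "2 * int (card S) \<le> int (card (P <+> Bs))" using S(2) card_verts by simp
  then have "2 * real (card S) \<le> real (card (P <+> Bs))" by linarith
  moreover have "S \<noteq> {}" using cS pos by auto
  ultimately have SS: "S \<in> \<S>" using S(1) by (auto simp: \<S>_def)
  have "real_of_int (int (card (nbhd ?G S))) \<le> real_of_int (int n ^ 3 + 1 - int k)"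
    using S(3) by (simp only: of_int_le_iff)
  then have N: "real (card (nbhd ?G S)) \<le> real n ^ 3 + 1 - real k" by simp
  have "Min (f ` \<S>) \<le> f S" using fin SS by (intro Min_le) auto
  also have "\<dots> \<le> (real n ^ 3 + 1 - real k) / (real n ^ 2 * (real n ^ 2 + 1) / 2)"
    unfolding f_def cS using pos N by (intro divide_right_mono) auto
  finally have upper: "Min (f ` \<S>) \<le> 2 * (real n ^ 3 + 1 - real k) / (real n ^ 2 * (real n ^ 2 + 1))"
    by (simp add: field_simps)
  have lower: "2 * (real n ^ 3 + 1 - real_of_int \<lfloor>unital_c n\<rfloor>) / (real n ^ 2 * (real n ^ 2 + 1)) \<le> f S"
    if S: "S \<in> \<S>" for S
  proof -
    have "2 * int (card S) \<le> int (card (P <+> Bs))" using S by (auto simp: \<S>_def)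
    then have "2 * (int n ^ 3 + 1 - \<lfloor>unital_c n\<rfloor>) * int (card S)
        \<le> int n ^ 2 * (int n ^ 2 + 1) * int (card (nbhd ?G S))"
      using S by (intro expansion_lower_bound) (auto simp: \<S>_def)
    then have "real_of_int (2 * (int n ^ 3 + 1 - \<lfloor>unital_c n\<rfloor>) * int (card S))
        \<le> real_of_int (int n ^ 2 * (int n ^ 2 + 1) * int (card (nbhd ?G S)))"
      by (simp only: of_int_le_iff)
    then have "2 * (real n ^ 3 + 1 - real_of_int \<lfloor>unital_c n\<rfloor>) * real (card S)
        \<le> real n ^ 2 * (real n ^ 2 + 1) * real (card (nbhd ?G S))" by simp
    moreover have "real (card S) > 0"
      using S finV by (auto simp: \<S>_def card_gt_0_iff intro: finite_subset)
    ultimately show ?thesis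
      unfolding f_def using pos by (simp add: divide_le_eq le_divide_eq mult.commute)
  qed
  have "2 * (real n ^ 3 + 1 - real_of_int \<lfloor>unital_c n\<rfloor>) / (real n ^ 2 * (real n ^ 2 + 1)) \<le> Min (f ` \<S>)"
    using fin SS lower by (subst Min_ge_iff) auto
  with upper show ?thesis unfolding iso k(3) by simp
qed

end
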